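(* Let $\mathcal X$ be a $C^2$ vector field near the origin of $\mathbb R^2$, with $\mathcal X(0)=0$ and $A:=D\mathcal X(0)$ satisfying $A\neq0$, $A^2=0$. Let $q_0\neq 0$ be a generator of $K=\ker A$, let $\mathcal R_{\mathcal X}$ be the distinguished restriction defined near $0$ by $A\mathcal X(uq_0)=\mathcal R_{\mathcal X}(u)q_0$, and let $g_2$ be its quadratic Taylor coefficient, $\mathcal R_{\mathcal X}(u)=g_2u^2+o(u^2)$. Then $$g_2=-\frac12\,D_{q_0}\bigl(\det D\mathcal X\bigr)(0),$$ where $D_{q_0}$ denotes the directional derivative along $q_0$. Consequently, $g_2$ coincides with the quadratic Bogdanov--Takens normal form coefficient $a$.
   Context: Since $A\ne0$ and $A^2=0$, $\ker A=\operatorname{im}A=K$ is one-dimensional, so $A\mathcal X(uq_0)\in K$ and $\mathcal R_{\mathcal X}$ is well defined; it satisfies $\mathcal R_{\mathcal X}(0)=\mathcal R_{\mathcal X}'(0)=0$. The quadratic Bogdanov--Takens coefficients $a,b$ (relative to the normalization given by $q_0$) are defined as follows: choose $q_1$ with $Aq_1=q_0$ and write $z=uq_0+vq_1$, so that $\dot z=\mathcal X(z)$ becomes $\dot u=v+\mathcal F(u,v)$, $\dot v=\mathcal G(u,v)$ with $\mathcal F,\mathcal G=\mathcal O(\|(u,v)\|^2)$; a quadratic near-identity polynomial change of variables $(u,v)\mapsto(w_0,w_1)=(u,v)+(\text{homogeneous quadratic terms})+\cdots$ brings the system to the form $\dot w_0=w_1+o(\|w\|^2)$, $\dot w_1=a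 w_0^2+b w_0w_1+o(\|w\|^2)$. *)

theory Defs
  imports "HOL-Analysis.Analysis" "HOL-Library.Landau_Symbols"
begin

definition C2_on :: "'a::real_normed_vector set \<Rightarrow> ('a \<Rightarrow> 'b::real_normed_vector) \<Rightarrow> bool" where
  "C2_on U f \<longleftrightarrow>
     (\<exists>(f' :: 'a \<Rightarrow> 'a \<Rightarrow>\<^sub>L 'b) (f'' :: 'a \<Rightarrow> 'a \<Rightarrow>\<^sub>L 'a \<Rightarrow>\<^sub>L 'b).
        (\<forall>x\<in>U. (f has_derivative blinfun_apply (f' x)) (at x)) \<and>
        (\<forall>x\<in>U. (f' has_derivative blinfun_apply (f'' x)) (at x)) \<and>
        continuous_on U f'')"

definition directional_derivative :: "'a::real_normed_vector \<Rightarrow> ('a \<Rightarrow> real) \<Rightarrow> 'a \<Rightarrow> real" where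
  "directional_derivative q f x = deriv (\<lambda>t. f (x + t *\<^sub>R q)) 0"

text \<open>The values below are meaningful where the unique existence demanded by \<open>THE\<close> holds:
  for the restriction when \<open>A (X (u q0))\<close> lies on the line through \<open>q0 \<noteq> 0\<close>, and for the
  coefficient when a second order expansion at 0 exists.\<close>

definition distinguished_restriction :: "(real^2 \<Rightarrow> real^2) \<Rightarrow> real^2 \<Rightarrow> real \<Rightarrow> real" where
  "distinguished_restriction X q0 u =
     (THE r. jacobian X (at 0) *v X (u *\<^sub>R q0) = r *\<^sub>R q0)"

definition quadratic_taylor_coeff :: "(real \<Rightarrow> real) \<Rightarrow> real" where
  "quadratic_taylor_coeff R =
     (THE c2. \<exists>c0 c1. (\<lambda>u. R u - (c0 + c1 * u + c2 * u^2)) \<in> o[at 0](\<lambda>u. u^2))"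

definition near_identity_polynomial :: "(real \<times> real \<Rightarrow> real \<times> real) \<Rightarrow> bool" where
  "near_identity_polynomial \<Phi> \<longleftrightarrow>
     (\<exists>(N::nat) (c :: nat \<Rightarrow> nat \<Rightarrow> real) (d :: nat \<Rightarrow> nat \<Rightarrow> real). \<forall>u v.
        \<Phi> (u, v) =
          (u + (\<Sum>(i, j) \<in> {(i, j). 2 \<le> i + j \<and> i + j \<le> N}. c i j * u^i * v^j),
           v + (\<Sum>(i, j) \<in> {(i, j). 2 \<le> i + j \<and> i + j \<le> N}. d i j * u^i * v^j)))"

text \<open>\<open>F\<close> and \<open>G\<close> give the system in the coordinates \<open>z = u q0 + v q1\<close>.  The field \<open>Z\<close> is the
  system in the new coordinates \<open>w = \<Phi> (u, v)\<close>, that is, the push-forward of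
  \<open>(v + F, G)\<close> under \<open>\<Phi>\<close>, which is a local diffeomorphism at the origin.\<close>

definition BT_coefficients ::
    "(real^2 \<Rightarrow> real^2) \<Rightarrow> real^2 \<Rightarrow> real^2 \<Rightarrow> real \<Rightarrow> real \<Rightarrow> bool" where
  "BT_coefficients X q0 q1 a b \<longleftrightarrow>
     (\<exists>(F :: real \<times> real \<Rightarrow> real) (G :: real \<times> real \<Rightarrow> real)
        (\<Phi> :: real \<times> real \<Rightarrow> real \<times> real) (Z :: real \<times> real \<Rightarrow> real \<times> real).
        (\<forall>\<^sub>F (u, v) in nhds 0.
           X (u *\<^sub>R q0 + v *\<^sub>R q1) = (v + F (u, v)) *\<^sub>R q0 + G (u, v) *\<^sub>R q1) \<and>
        F \<in> O[at 0](\<lambda>p. (norm p)^2) \<and>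
        G \<in> O[at 0](\<lambda>p. (norm p)^2) \<and>
        near_identity_polynomial \<Phi> \<and>
        (\<forall>\<^sub>F (u, v) in nhds 0.
           frechet_derivative \<Phi> (at (u, v)) (v + F (u, v), G (u, v)) = Z (\<Phi> (u, v))) \<and>
        (\<lambda>w. fst (Z w) - snd w) \<in> o[at 0](\<lambda>w. (norm w)^2) \<and>
        (\<lambda>w. snd (Z w) - (a * (fst w)^2 + b * fst w * snd w)) \<in> o[at 0](\<lambda>w. (norm w)^2))"

end

theory Submission
  imports Defs
begin

text \<open>
  Since \<open>A\<close> is nonzero and \<open>A\<^sup>2 = 0\<close>, there is a linear functional \<open>l1\<close> with
  \<open>A z = l1 z q0\<close>. It vanishes at \<open>q0\<close> and takes the value 1 at every \<open>q1\<close> with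
  \<open>A q1 = q0\<close>, so it is the \<open>v\<close>-coordinate of \<open>z = u q0 + v q1\<close>. Hence the distinguished
  restriction is \<open>R u = l1 (X (u q0)) = G (u, 0)\<close>, the second component of the planar system along
  the axis \<open>v = 0\<close>, and Taylor's formula at order two gives \<open>g2 = l1 (H q0 q0) / 2\<close>, where
  \<open>H\<close> is the second derivative of \<open>X\<close> at 0.

  \<^emph>\<open>The determinant.\<close> The derivative of \<open>det\<close> at a 2-by-2 matrix \<open>A\<close> in the direction \<open>B\<close> is
  the trace of \<open>adj A * B\<close>, and \<open>adj A = - A\<close> because the trace of \<open>A\<close> is \<open>l1 q0 = 0\<close>. For
  \<open>B = H q0\<close> this is minus the trace of the rank-one map \<open>z \<mapsto> l1 (H q0 z) q0\<close>, that is,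
  \<open>- l1 (H q0 q0) = - 2 g2\<close> (\<open>det_jacobian_has_derivative\<close>).

  \<^emph>\<open>The normal form coefficient is forced.\<close> It suffices to look at the conjugacy equation on the axis
  \<open>v = 0\<close>. There \<open>\<Phi> (u, 0) = (u, 0) + o(u)\<close>, so the second component of the normal form is
  \<open>a u\<^sup>2 + o(u\<^sup>2)\<close>; and since \<open>D\<Phi>\<close> tends to the identity while \<open>F\<close> and \<open>G\<close> are
  \<open>O(u\<^sup>2)\<close>, the second component of the pushed forward field is \<open>G (u, 0) + o(u\<^sup>2)\<close>. Thus
  \<open>R u = a u\<^sup>2 + o(u\<^sup>2)\<close> (\<open>BT_coefficients_leading\<close>), and \<open>a = g2\<close>.

  \<^emph>\<open>A normal form exists.\<close> Write \<open>F2\<close> and \<open>G2\<close> for the quadratic parts. The substitution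
  \<open>w0 = u + \<alpha> u\<^sup>2\<close>, \<open>w1 = v + F2 + 2 \<alpha> u v\<close> makes the first component equal to \<open>w1\<close> up to
  \<open>o(\<parallel>w\<parallel>\<^sup>2)\<close> for every \<open>\<alpha>\<close>, and changes the quadratic part of the second one to
  \<open>G2 + v \<partial>F2/\<partial>u + 2 \<alpha> v\<^sup>2\<close>. The constant \<open>\<alpha>\<close> is chosen to cancel the term
  \<open>v\<^sup>2\<close> (\<open>BT_coefficients_exist\<close>).
\<close>

section \<open>Second order Taylor expansion\<close>

text \<open>Along the segment from 0 to \<open>h\<close> the remainder is a differentiable curve, whose velocity at
  time \<open>t\<close> is the first order remainder of \<open>f'\<close> at \<open>t h\<close> applied to \<open>h\<close>, hence
  \<open>o(\<parallel>h\<parallel>\<^sup>2)\<close>; the mean value inequality finishes the proof.\<close>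

lemma second_order_taylor:
  fixes f :: "'a::real_normed_vector \<Rightarrow> 'b::real_normed_vector"
    and f' :: "'a \<Rightarrow> 'a \<Rightarrow>\<^sub>L 'b" and f'' :: "'a \<Rightarrow>\<^sub>L 'a \<Rightarrow>\<^sub>L 'b"
  assumes U: "open U" "0 \<in> U"
    and f': "\<And>x. x \<in> U \<Longrightarrow> (f has_derivative f' x) (at x)"
    and f'': "(f' has_derivative f'') (at 0)"
  shows "(\<lambda>h. norm (f h - f 0 - f' 0 h - (1/2) *\<^sub>R f'' h h)) \<in> o[at 0](\<lambda>h. (norm h)^2)"
proof (rule landau_o.smallI)
  fix c :: real assume c: "c > 0"
  obtain r where r: "r > 0" "ball 0 r \<subseteq> U"
    using U open_contains_ball by blast
  obtain d where d: "d > 0"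
    "\<And>h. norm h < d \<Longrightarrow> norm (f' h - f' 0 - f'' h) \<le> c * norm h"
    using f'' c unfolding has_derivative_at_alt by (metis diff_zero)
  have main: "norm (f h - f 0 - f' 0 h - (1/2) *\<^sub>R f'' h h) \<le> c * (norm h)^2"
    if h: "norm h < min r d" for h
  proof -
    define E where "E t = f (t *\<^sub>R h) - t *\<^sub>R f' 0 h - (t^2/2) *\<^sub>R f'' h h" for t :: real
    define E' where "E' t = (f' (t *\<^sub>R h) - f' 0 - f'' (t *\<^sub>R h)) h" for t :: real
    have small: "norm (t *\<^sub>R h) \<le> norm h" if "t \<in> {0..1}" for t :: real
      using that mult_right_mono[of t 1 "norm h"] by simp
    have der: "(E has_derivative (\<lambda>s. s *\<^sub>R E' t)) (at t within {0..1})" if t: "t \<in> {0..1}" for t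
    proof -
      have "t *\<^sub>R h \<in> U" using small[OF t] h r by (auto simp: subset_iff)
      then have 1: "(f has_derivative f' (t *\<^sub>R h)) (at (t *\<^sub>R h))" by (rule f')
      have 2: "((\<lambda>t. f (t *\<^sub>R h)) has_derivative (\<lambda>s. f' (t *\<^sub>R h) (s *\<^sub>R h))) (at t within {0..1})"
        by (rule has_derivative_compose[where f = "\<lambda>t. t *\<^sub>R h", OF _ 1]) (auto intro!: derivative_eq_intros)
      show ?thesis
        unfolding E_def
        by (rule derivative_eq_intros 2 refl)+
           (auto simp: fun_eq_iff E'_def blinfun.bilinear_simps algebra_simps)
    qed
    have bd: "onorm (\<lambda>s. s *\<^sub>R E' t) \<le> c * (norm h)^2" if t: "t \<in> {0..1}" for t
    proof (rule onorm_bound)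
      fix s :: real
      have "norm (E' t) \<le> norm (f' (t *\<^sub>R h) - f' 0 - f'' (t *\<^sub>R h)) * norm h"
        unfolding E'_def by (rule norm_blinfun)
      also have "\<dots> \<le> (c * norm (t *\<^sub>R h)) * norm h"
        using small[OF t] h by (intro mult_right_mono d) auto
      also have "\<dots> \<le> (c * norm h) * norm h"
        using small[OF t] c by (intro mult_right_mono mult_left_mono) auto
      finally have "norm (E' t) \<le> c * (norm h)^2" by (simp add: power2_eq_square algebra_simps)
      then show "norm (s *\<^sub>R E' t) \<le> c * (norm h)^2 * norm s"
        by (metis mult.commute mult_left_mono norm_ge_zero norm_scaleR real_norm_def)
    qed (use c in auto)
    have "norm (E 1 - E 0) \<le> c * (norm h)^2 * norm (1 - 0 :: real)"
      by (rule differentiable_bound[OF _ der bd]) auto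
    then show ?thesis by (simp add: E_def algebra_simps)
  qed
  show "eventually (\<lambda>h. norm (norm (f h - f 0 - f' 0 h - (1/2) *\<^sub>R f'' h h)) \<le> c * norm ((norm h)^2)) (at 0)"
    unfolding eventually_at using r(1) d(1) main
    by (intro exI[of _ "min r d"]) auto
qed

text \<open>The form in which the expansion is used: one coordinate \<open>l\<close> of the field, read in linear
  coordinates \<open>T\<close> on a line or on the plane. The estimate is about points
  other than 0, which \<open>T\<close> must therefore not send to 0.\<close>

lemma second_order_taylor_coordinates:
  fixes f :: "'a::real_normed_vector \<Rightarrow> 'b::real_normed_vector"
    and f' :: "'a \<Rightarrow> 'a \<Rightarrow>\<^sub>L 'b" and f'' :: "'a \<Rightarrow>\<^sub>L 'a \<Rightarrow>\<^sub>L 'b"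
    and T :: "'c::real_normed_vector \<Rightarrow> 'a" and l :: "'b \<Rightarrow> real"
  assumes taylor: "open U" "0 \<in> U" "\<And>x. x \<in> U \<Longrightarrow> (f has_derivative f' x) (at x)"
      "(f' has_derivative f'') (at 0)"
    and T: "bounded_linear T" "\<And>p. T p = 0 \<Longrightarrow> p = 0" and l: "bounded_linear l"
  shows "(\<lambda>p. l (f (T p)) - l (f 0) - l (f' 0 (T p)) - (1/2) * l (f'' (T p) (T p)))
    \<in> o[at 0](\<lambda>p. (norm p)^2)"
proof -
  define E where "E h = f h - f 0 - f' 0 h - (1/2) *\<^sub>R f'' h h" for h
  obtain K where K: "\<And>p. norm (T p) \<le> norm p * K" using bounded_linear.bounded[OF T(1)] by blast
  obtain L where L: "\<And>y. norm (l y) \<le> norm y * L" using bounded_linear.bounded[OF l] by blast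
  have lim: "filterlim T (at 0) (at 0)"
    using T(2) bounded_linear.tendsto[OF T(1) tendsto_ident_at, of 0 UNIV]
    by (intro filterlim_atI) (auto simp: linear_simps[OF T(1)] eventually_at_filter intro!: always_eventually)
  have "(\<lambda>h. norm (E h)) \<in> o[at 0](\<lambda>h. (norm h)^2)"
    unfolding E_def by (rule second_order_taylor[OF taylor])
  then have "(\<lambda>p. norm (E (T p))) \<in> o[at 0](\<lambda>p. (norm (T p))^2)"
    by (rule landau_o.small.compose[OF _ lim])
  moreover have "(\<lambda>p. norm (T p)) \<in> O[at 0](\<lambda>p. norm p)"
    using K by (intro bigoI[of _ K]) (simp add: mult.commute)
  then have "(\<lambda>p. (norm (T p))^2) \<in> O[at 0](\<lambda>p. (norm p)^2)" by (rule landau_o.big_power)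
  ultimately have "(\<lambda>p. norm (E (T p))) \<in> o[at 0](\<lambda>p. (norm p)^2)" by (rule landau_o.small_big_trans)
  moreover have "(\<lambda>p. l (E (T p))) \<in> O[at 0](\<lambda>p. norm (E (T p)))"
    using L by (intro bigoI[of _ L]) (simp add: mult.commute)
  ultimately have "(\<lambda>p. l (E (T p))) \<in> o[at 0](\<lambda>p. (norm p)^2)"
    by (rule landau_o.big_small_trans[rotated])
  then show ?thesis by (simp add: E_def linear_simps[OF l])
qed

section \<open>The quadratic Taylor coefficient\<close>

lemma quadratic_smallo_zero:
  fixes c0 c1 c2 :: real
  assumes "(\<lambda>u. c0 + c1 * u + c2 * u^2) \<in> o[at 0](\<lambda>u. u^2)"
  shows "c2 = 0"
proof -
  have lim: "((\<lambda>u. (c0 + c1 * u + c2 * u^2) / u^2) \<longlongrightarrow> 0) (at 0)"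
    using assms by (rule smalloD_tendsto)
  have "((\<lambda>u::real. u^2) \<longlongrightarrow> 0) (at 0)" "((\<lambda>u::real. u) \<longlongrightarrow> 0) (at 0)"
    by (auto intro!: tendsto_eq_intros)
  note ps = this
  have ne: "\<forall>\<^sub>F u in at (0::real). u \<noteq> 0" by (simp add: eventually_at_filter)
  have "((\<lambda>u. (c0 + c1 * u + c2 * u^2) / u^2 * u^2) \<longlongrightarrow> 0) (at 0)"
    using tendsto_mult[OF lim ps(1)] by simp
  then have "((\<lambda>u. c0 + c1 * u + c2 * u^2) \<longlongrightarrow> 0) (at 0)"
    by (rule Lim_transform_eventually) (rule eventually_mono[OF ne], simp)
  moreover have "((\<lambda>u. c0 + c1 * u + c2 * u^2) \<longlongrightarrow> c0) (at 0)"
    by (auto intro!: tendsto_eq_intros)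
  ultimately have c0: "c0 = 0" using LIM_unique by blast
  have "((\<lambda>u. (c0 + c1 * u + c2 * u^2) / u^2 * u) \<longlongrightarrow> 0) (at 0)"
    using tendsto_mult[OF lim ps(2)] by simp
  then have "((\<lambda>u. c1 + c2 * u) \<longlongrightarrow> 0) (at 0)"
    by (rule Lim_transform_eventually)
       (rule eventually_mono[OF ne], simp add: c0 power2_eq_square field_simps)
  moreover have "((\<lambda>u. c1 + c2 * u) \<longlongrightarrow> c1) (at 0)"
    by (auto intro!: tendsto_eq_intros)
  ultimately have c1: "c1 = 0" using LIM_unique by blast
  have "((\<lambda>u::real. c2) \<longlongrightarrow> 0) (at 0)"
    using lim by (rule Lim_transform_eventually) (rule eventually_mono[OF ne], simp add: c0 c1)
  then show "c2 = 0" using LIM_unique tendsto_const by blast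
qed

lemma quadratic_taylor_coeff_eqI:
  assumes "(\<lambda>u. R u - c2 * u^2) \<in> o[at 0](\<lambda>u. u^2)"
  shows "quadratic_taylor_coeff R = c2"
  unfolding quadratic_taylor_coeff_def
proof (rule the_equality)
  show "\<exists>c0 c1. (\<lambda>u. R u - (c0 + c1 * u + c2 * u^2)) \<in> o[at 0](\<lambda>u. u^2)"
    using assms by (intro exI[of _ 0]) simp
next
  fix c assume "\<exists>c0 c1. (\<lambda>u. R u - (c0 + c1 * u + c * u^2)) \<in> o[at 0](\<lambda>u. u^2)"
  then obtain c0 c1 where "(\<lambda>u. R u - (c0 + c1 * u + c * u^2)) \<in> o[at 0](\<lambda>u. u^2)" by blast
  from sum_in_smallo(2)[OF assms this]
  have "(\<lambda>u. c0 + c1 * u + (c - c2) * u^2) \<in> o[at 0](\<lambda>u. u^2)"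
    by (simp add: algebra_simps)
  from quadratic_smallo_zero[OF this] show "c = c2" by simp
qed

section \<open>The derivative of the Jacobian determinant\<close>

lemma directional_derivative_eq:
  assumes "(f has_derivative D) (at x)"
  shows "directional_derivative q f x = D q"
proof -
  have "((\<lambda>t. f (x + t *\<^sub>R q)) has_derivative (\<lambda>t. D (t *\<^sub>R q))) (at 0)"
    by (rule has_derivative_compose[where f = "\<lambda>t. x + t *\<^sub>R q" and g = f])
       (auto intro!: derivative_eq_intros simp: assms)
  then have "((\<lambda>t. f (x + t *\<^sub>R q)) has_field_derivative D q) (at 0)"
    by (rule has_derivative_imp_has_field_derivative)
       (simp add: linear_scale[OF has_derivative_linear[OF assms]])
  then show ?thesis unfolding directional_derivative_def by (rule DERIV_imp_deriv)
qed

lemma linear_functional_2: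
  fixes l :: "real^2 \<Rightarrow> real"
  assumes "linear l"
  shows "l y = l (axis 1 1) * y $ 1 + l (axis 2 1) * y $ 2"
proof -
  have "y = (y $ 1) *\<^sub>R axis 1 1 + (y $ 2) *\<^sub>R axis 2 1"
    by (simp add: vec_eq_iff forall_2 axis_def)
  then have "l y = l ((y $ 1) *\<^sub>R axis 1 1 + (y $ 2) *\<^sub>R axis 2 1)" by (rule arg_cong)
  then show ?thesis using assms by (simp add: linear_add linear_scale)
qed

text \<open>By Jacobi's formula the derivative in the direction \<open>q\<close> is the trace of \<open>adj A * f'' q\<close>. The
  derivative \<open>A = f' 0\<close> has rank at most one with trace \<open>l q = 0\<close>, so \<open>adj A = - A\<close>, and the trace of
  \<open>z \<mapsto> l (f'' q z) q\<close> is \<open>l (f'' q q)\<close>.\<close>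

lemma det_jacobian_has_derivative:
  fixes X :: "real^2 \<Rightarrow> real^2" and f' :: "real^2 \<Rightarrow> ((real^2) \<Rightarrow>\<^sub>L (real^2))"
    and f'' :: "(real^2) \<Rightarrow>\<^sub>L ((real^2) \<Rightarrow>\<^sub>L (real^2))"
  assumes U: "open U" "0 \<in> U"
    and f': "\<And>x. x \<in> U \<Longrightarrow> (X has_derivative f' x) (at x)"
    and f'': "(f' has_derivative f'') (at 0)"
    and l: "linear l" "l q = 0" "\<And>z. f' 0 z = l z *\<^sub>R q"
  obtains D where "((\<lambda>x. det (jacobian X (at x))) has_derivative D) (at 0)"
    "D q = - l (f'' q q)"
proof
  define e :: "2 \<Rightarrow> real^2" where "e j = axis j 1" for j
  have J: "jacobian X (at x) $ i $ j = f' x (e j) $ i" if "x \<in> U" for x i j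
    using frechet_derivative_at[OF f'[OF that]] by (simp add: jacobian_def matrix_def e_def)
  have ent: "((\<lambda>x. f' x (e j) $ i) has_derivative (\<lambda>h. f'' h (e j) $ i)) (at 0)" for i j
    by (rule bounded_linear.has_derivative
        [OF bounded_linear_compose[OF bounded_linear_vec_nth blinfun.bounded_linear_left] f''])
  define D where "D h = f' 0 (e 1) $ 1 * f'' h (e 2) $ 2 + f'' h (e 1) $ 1 * f' 0 (e 2) $ 2
      - (f' 0 (e 2) $ 1 * f'' h (e 1) $ 2 + f'' h (e 2) $ 1 * f' 0 (e 1) $ 2)" for h
  have "((\<lambda>x. f' x (e 1) $ 1 * f' x (e 2) $ 2 - f' x (e 2) $ 1 * f' x (e 1) $ 2)
      has_derivative D) (at 0)"
    unfolding D_def[abs_def] by (intro has_derivative_diff has_derivative_mult ent)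
  then show "((\<lambda>x. det (jacobian X (at x))) has_derivative D) (at 0)"
    by (rule has_derivative_transform_within_open[OF _ U]) (simp add: det_2 J)
  \<comment> \<open>The trace of the rank-one map \<open>z \<mapsto> l z q\<close> is \<open>l q = 0\<close>.\<close>
  have tr: "l (e 1) * q $ 1 + l (e 2) * q $ 2 = 0"
    using linear_functional_2[OF l(1), of q] l(2) by (simp add: e_def)
  have q: "q = (q $ 1) *\<^sub>R e 1 + (q $ 2) *\<^sub>R e 2"
    by (simp add: vec_eq_iff forall_2 axis_def e_def)
  define H where "H = f'' q"
  have Hq: "H q = (q $ 1) *\<^sub>R H (e 1) + (q $ 2) *\<^sub>R H (e 2)"
    by (subst q) (simp add: blinfun.bilinear_simps)
  have "l (H q) = q $ 1 * l (H (e 1)) + q $ 2 * l (H (e 2))"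
    unfolding Hq using l(1) by (simp add: linear_add linear_scale)
  \<comment> \<open>For 2-by-2 matrices \<open>tr (A B) = - tr (adj A B) + tr A * tr B\<close>, and \<open>D q = tr (adj A H)\<close>.\<close>
  also have "\<dots> = - D q + (l (e 1) * q $ 1 + l (e 2) * q $ 2) * (H (e 1) $ 1 + H (e 2) $ 2)"
    unfolding D_def linear_functional_2[OF l(1), of "H _"] l(3) H_def[symmetric]
    by (simp add: e_def[symmetric] algebra_simps)
  finally show "D q = - l (f'' q q)" using tr by (simp add: H_def)
qed

section \<open>The leading normal form coefficient is determined by the field\<close>

text \<open>The nonlinear part of a near-identity polynomial map has partial derivatives \<open>P\<close> and \<open>S\<close> that
  vanish at 0 and are continuous there, since a monomial of degree at least two has gradient 0 at 0.\<close>

lemma polynomial_higher_order_derivative: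
  fixes c :: "nat \<Rightarrow> nat \<Rightarrow> real" and N :: nat
    and q :: "real \<times> real \<Rightarrow> real"
  assumes q_def: "\<And>p. q p = (\<Sum>(i, j) \<in> {(i, j). 2 \<le> i + j \<and> i + j \<le> N}. c i j * fst p^i * snd p^j)"
  obtains P S where "q 0 = 0" "\<And>p. (q has_derivative (\<lambda>h. P p * fst h + S p * snd h)) (at p)"
    "P 0 = 0" "S 0 = 0" "(P \<longlongrightarrow> 0) (nhds 0)" "(S \<longlongrightarrow> 0) (nhds 0)"
proof
  let ?I = "{(i, j). 2 \<le> i + j \<and> i + j \<le> N}"
  show "q 0 = 0"
    unfolding q_def by (auto intro!: sum.neutral simp: power_0_left)
  define P where "P p = (\<Sum>(i, j)\<in>?I. c i j * (real i * fst p^(i-1)) * snd p^j)" for p :: "real \<times> real"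
  define S where "S p = (\<Sum>(i, j)\<in>?I. c i j * fst p^i * (real j * snd p^(j-1)))" for p :: "real \<times> real"
  show "(q has_derivative (\<lambda>h. P p * fst h + S p * snd h)) (at p)" for p
  proof -
    have "(q has_derivative (\<lambda>h. \<Sum>(i, j)\<in>?I. c i j * (real i * fst p^(i-1)) * snd p^j * fst h
        + c i j * fst p^i * (real j * snd p^(j-1)) * snd h)) (at p)"
      unfolding q_def[abs_def]
      by (rule has_derivative_sum, clarsimp) (auto intro!: derivative_eq_intros simp: algebra_simps)
    then show ?thesis
      by (simp add: P_def S_def sum_distrib_right sum.distrib case_prod_unfold)
  qed
  have "isCont P 0" "isCont S 0"
    unfolding P_def S_def case_prod_unfold by (intro continuous_intros)+
  moreover show "P 0 = 0" "S 0 = 0"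
    unfolding P_def S_def by (auto intro!: sum.neutral simp: power_0_left)
  ultimately show "(P \<longlongrightarrow> 0) (nhds 0)" "(S \<longlongrightarrow> 0) (nhds 0)"
    by (metis isCont_def tendsto_at_iff_tendsto_nhds)+
qed

text \<open>On the axis \<open>v = 0\<close> the new coordinates are \<open>(u, 0) + o(u)\<close>, so the mixed term
  \<open>b w0 w1\<close> is invisible at order two and \<open>a w0\<^sup>2\<close> is \<open>a u\<^sup>2\<close>; on the other side
  \<open>D\<Phi>\<close> is the identity up to \<open>o(1)\<close> and only meets terms that are \<open>O(u\<^sup>2)\<close>. The functional
  \<open>l1\<close> reads off the coordinate along \<open>q1\<close>.\<close>

lemma BT_coefficients_leading:
  fixes l1 :: "real^2 \<Rightarrow> real"
  assumes BT: "BT_coefficients X q0 q1 a b"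
    and l1: "linear l1" "l1 q0 = 0" "l1 q1 = 1"
  shows "(\<lambda>u. l1 (X (u *\<^sub>R q0)) - a * u^2) \<in> o[at 0](\<lambda>u. u^2)"
proof -
  obtain F G \<Phi> Z where
    X: "\<forall>\<^sub>F (u, v) in nhds 0.
      X (u *\<^sub>R q0 + v *\<^sub>R q1) = (v + F (u, v)) *\<^sub>R q0 + G (u, v) *\<^sub>R q1"
    and F: "F \<in> O[at 0](\<lambda>p. (norm p)^2)" and G: "G \<in> O[at 0](\<lambda>p. (norm p)^2)"
    and \<Phi>: "near_identity_polynomial \<Phi>"
    and conj: "\<forall>\<^sub>F (u, v) in nhds 0.
      frechet_derivative \<Phi> (at (u, v)) (v + F (u, v), G (u, v)) = Z (\<Phi> (u, v))"
    and Z: "(\<lambda>w. snd (Z w) - (a * (fst w)^2 + b * fst w * snd w)) \<in> o[at 0](\<lambda>w. (norm w)^2)"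
    using BT unfolding BT_coefficients_def by (elim exE conjE) (rule that)
  obtain N :: nat and c d where \<Phi>_eq0: "\<And>u v. \<Phi> (u, v) =
     (u + (\<Sum>(i, j) \<in> {(i, j). 2 \<le> i + j \<and> i + j \<le> N}. c i j * u^i * v^j),
      v + (\<Sum>(i, j) \<in> {(i, j). 2 \<le> i + j \<and> i + j \<le> N}. d i j * u^i * v^j))"
    using \<Phi> unfolding near_identity_polynomial_def by (elim exE) (rule that, elim allE, assumption)
  define p where "p z = (\<Sum>(i, j) \<in> {(i, j). 2 \<le> i + j \<and> i + j \<le> N}. c i j * fst z^i * snd z^j)" for z
  define q where "q z = (\<Sum>(i, j) \<in> {(i, j). 2 \<le> i + j \<and> i + j \<le> N}. d i j * fst z^i * snd z^j)" for z
  have \<Phi>_eq: "\<Phi> z = (fst z + p z, snd z + q z)" for z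
    using \<Phi>_eq0[of "fst z" "snd z"] by (simp add: p_def q_def)
  obtain P S where p: "p 0 = 0" "\<And>z. (p has_derivative (\<lambda>h. P z * fst h + S z * snd h)) (at z)"
    "P 0 = 0" "S 0 = 0" "(P \<longlongrightarrow> 0) (nhds 0)" "(S \<longlongrightarrow> 0) (nhds 0)"
    by (rule polynomial_higher_order_derivative[OF p_def]) (rule that)
  obtain P' S' where q: "q 0 = 0" "\<And>z. (q has_derivative (\<lambda>h. P' z * fst h + S' z * snd h)) (at z)"
    "P' 0 = 0" "S' 0 = 0" "(P' \<longlongrightarrow> 0) (nhds 0)" "(S' \<longlongrightarrow> 0) (nhds 0)"
    by (rule polynomial_higher_order_derivative[OF q_def]) (rule that)
  have D\<Phi>: "snd (frechet_derivative \<Phi> (at z) h) = snd h + (P' z * fst h + S' z * snd h)" for z h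
  proof -
    have "(\<Phi> has_derivative (\<lambda>h. (fst h + (P z * fst h + S z * snd h),
        snd h + (P' z * fst h + S' z * snd h)))) (at z)"
      unfolding \<Phi>_eq[abs_def] by (rule derivative_eq_intros p(2) q(2) refl)+
    from fun_cong[OF frechet_derivative_at[OF this], of h, symmetric] show ?thesis by simp
  qed
  have axis: "filterlim (\<lambda>u. (u, 0)) (at (0 :: real \<times> real)) (at (0 :: real))"
    by (intro filterlim_atI)
       (auto intro!: tendsto_eq_intros simp: zero_prod_def eventually_at_filter)
  have norm_axis: "norm (u :: real, 0 :: real) = \<bar>u\<bar>" for u by simp
  have axis_nhds: "filterlim (\<lambda>u. (u, 0)) (nhds (0 :: real \<times> real)) (at (0 :: real))"
    using axis by (simp add: filterlim_at)
  have F': "(\<lambda>u. F (u, 0)) \<in> O[at 0](\<lambda>u. u^2)" and G': "(\<lambda>u. G (u, 0)) \<in> O[at 0](\<lambda>u. u^2)"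
    using landau_o.big.compose[OF F axis] landau_o.big.compose[OF G axis] by simp_all
  have flat: "(\<lambda>u. f (u, 0)) \<in> o[at 0](\<lambda>u. u)"
    if "f 0 = 0" "(f has_derivative (\<lambda>h. 0)) (at 0)" for f :: "real \<times> real \<Rightarrow> real"
  proof -
    have "((\<lambda>h. norm (f h) / norm h) \<longlongrightarrow> 0) (at 0)"
      using that unfolding has_derivative_at by simp
    then have "((\<lambda>u. norm (f (u, 0)) / norm (u :: real, 0 :: real)) \<longlongrightarrow> 0) (at 0)"
      by (rule filterlim_compose[OF _ axis])
    then have "((\<lambda>u. norm (f (u, 0) / u)) \<longlongrightarrow> 0) (at 0)" by simp
    then have "((\<lambda>u. f (u, 0) / u) \<longlongrightarrow> 0) (at 0)" by (rule tendsto_norm_zero_cancel)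
    then show ?thesis by (intro smalloI_tendsto) (auto simp: eventually_at_filter)
  qed
  have po: "(\<lambda>u. p (u, 0)) \<in> o[at 0](\<lambda>u. u)" and qo: "(\<lambda>u. q (u, 0)) \<in> o[at 0](\<lambda>u. u)"
    using p(1) p(2)[of 0] q(1) q(2)[of 0] by (simp_all add: p(3,4) q(3,4) flat)
  \<comment> \<open>The image of the axis under \<open>\<Phi>\<close>: a curve with velocity \<open>(1, 0)\<close> at 0.\<close>
  define w where "w u = \<Phi> (u, 0)" for u :: real
  have w: "fst (w u) = u + p (u, 0)" "snd (w u) = q (u, 0)" for u
    by (simp_all add: w_def \<Phi>_eq)
  have w0: "(\<lambda>u. fst (w u)) \<in> O[at 0](\<lambda>u. u)"
    unfolding w by (intro sum_in_bigo landau_o.small_imp_big[OF po]) simp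
  have w1: "(\<lambda>u. snd (w u)) \<in> o[at 0](\<lambda>u. u)"
    unfolding w by (fact qo)
  have "norm (w u) \<le> \<bar>fst (w u)\<bar> + \<bar>snd (w u)\<bar>" for u
    using norm_Pair_le[of "fst (w u)" "snd (w u)"] by simp
  then have "(\<lambda>u. norm (w u)) \<in> O[at 0](\<lambda>u. \<bar>fst (w u)\<bar> + \<bar>snd (w u)\<bar>)"
    by (intro bigoI[of _ 1]) simp
  moreover have "(\<lambda>u. \<bar>fst (w u)\<bar> + \<bar>snd (w u)\<bar>) \<in> O[at 0](\<lambda>u. u)"
    using w0 landau_o.small_imp_big[OF w1] by (intro sum_in_bigo) simp_all
  ultimately have wn: "(\<lambda>u. norm (w u)) \<in> O[at 0](\<lambda>u. u)"
    by (rule landau_o.big_trans)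
  \<comment> \<open>The expansion of \<open>Z\<close> holds away from 0 only, so the curve must avoid 0.\<close>
  have wne: "\<forall>\<^sub>F u in at 0. w u \<noteq> 0"
  proof -
    have "\<forall>\<^sub>F u in at 0. norm (p (u, 0)) \<le> 1/2 * norm u"
      using landau_o.smallD[OF po, of "1/2"] by simp
    moreover have "\<forall>\<^sub>F u in at (0::real). u \<noteq> 0" by (simp add: eventually_at_filter)
    ultimately show ?thesis
    proof eventually_elim
      case (elim u)
      then have "fst (w u) \<noteq> 0" unfolding w by (auto simp: abs_if split: if_splits)
      then show ?case by auto
    qed
  qed
  have "(w \<longlongrightarrow> 0) (at 0)"
  proof -
    have "isCont \<Phi> 0"
      unfolding \<Phi>_eq[abs_def] p_def q_def case_prod_unfold by (intro continuous_intros)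
    moreover have "\<Phi> 0 = 0" by (simp add: \<Phi>_eq p(1) q(1) prod_eq_iff)
    ultimately have "(\<Phi> \<longlongrightarrow> 0) (nhds 0)"
      by (metis isCont_def tendsto_at_iff_tendsto_nhds)
    from filterlim_compose[OF this axis_nhds] show ?thesis
      unfolding w_def[abs_def] .
  qed
  then have wlim: "filterlim w (at 0) (at 0)"
    using wne by (intro filterlim_atI)
  have Zw: "(\<lambda>u. snd (Z (w u)) - (a * (fst (w u))^2 + b * fst (w u) * snd (w u))) \<in> o[at 0](\<lambda>u. u^2)"
    by (rule landau_o.small_big_trans[OF landau_o.small.compose[OF Z wlim]])
       (rule landau_o.big_power[OF wn])
  \<comment> \<open>The conjugacy equation on the axis, with \<open>D\<Phi>\<close> split into the identity and a small part.\<close>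
  have eq1: "\<forall>\<^sub>F u in at 0. snd (Z (w u)) = G (u, 0) + (P' (u, 0) * F (u, 0) + S' (u, 0) * G (u, 0))"
    using eventually_compose_filterlim[OF conj axis_nhds]
    by eventually_elim (auto simp: w_def D\<Phi> dest!: arg_cong[of _ _ snd])
  have eq2: "\<forall>\<^sub>F u in at 0. l1 (X (u *\<^sub>R q0)) = G (u, 0)"
    using eventually_compose_filterlim[OF X axis_nhds]
    by eventually_elim (simp add: linear_add[OF l1(1)] linear_scale[OF l1(1)] l1)
  have o1: "(\<lambda>u. h (u, 0) * k u) \<in> o[at 0](\<lambda>u. u^2)"
    if "(h \<longlongrightarrow> 0) (nhds 0)" "k \<in> O[at 0](\<lambda>u. u^2)" for h :: "real \<times> real \<Rightarrow> real" and k
  proof -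
    have "(\<lambda>u. h (u, 0)) \<in> o[at 0](\<lambda>u. 1)"
      using filterlim_compose[OF that(1) axis_nhds] by (intro smalloI_tendsto) auto
    from landau_o.small_big_mult[OF this that(2)] show ?thesis by simp
  qed
  have o2: "(\<lambda>u. h u * k u) \<in> o[at 0](\<lambda>u. u^2)"
    if "h \<in> o[at 0](\<lambda>u. u)" "k \<in> O[at 0](\<lambda>u. u)" for h k :: "real \<Rightarrow> real"
    using landau_o.small_big_mult[OF that] by (simp add: power2_eq_square)
  have c: "(\<lambda>u. x * h u) \<in> O[at 0](\<lambda>u. u)" if "h \<in> O[at 0](\<lambda>u. u)" for x and h :: "real \<Rightarrow> real"
    using that by (cases "x = 0") simp_all
  have "(\<lambda>u. a * (fst (w u) + u)) \<in> O[at 0](\<lambda>u. u)"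
    by (intro c sum_in_bigo w0) simp
  note o2p = o2[OF po this] and o2q = o2[OF w1 c[OF w0, of b]]
  \<comment> \<open>The difference \<open>G (u, 0) - a u\<^sup>2\<close>, written with
    \<open>w0\<^sup>2 - u\<^sup>2 = p (u, 0) (w0 + u)\<close>, where \<open>w0\<close> is the first coordinate of the curve.\<close>
  have "(\<lambda>u. (snd (Z (w u)) - (a * (fst (w u))^2 + b * fst (w u) * snd (w u)))
      + p (u, 0) * (a * (fst (w u) + u)) + snd (w u) * (b * fst (w u))
      - P' (u, 0) * F (u, 0) - S' (u, 0) * G (u, 0)) \<in> o[at 0](\<lambda>u. u^2)"
    by (intro sum_in_smallo Zw o2p o2q o1[OF q(5) F'] o1[OF q(6) G'])
  moreover have "\<forall>\<^sub>F u in at 0. (snd (Z (w u)) - (a * (fst (w u))^2 + b * fst (w u) * snd (w u)))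
      + p (u, 0) * (a * (fst (w u) + u)) + snd (w u) * (b * fst (w u))
      - P' (u, 0) * F (u, 0) - S' (u, 0) * G (u, 0) = l1 (X (u *\<^sub>R q0)) - a * u^2"
    using eq1 eq2
  proof eventually_elim
    case (elim u)
    show ?case unfolding elim w by (simp add: algebra_simps power2_eq_square)
  qed
  ultimately show ?thesis
    by (rule iffD1[OF landau_o.small.in_cong, rotated])
qed

section \<open>Existence of the normal form\<close>

lemma fst_bigo_norm: "fst \<in> O[F](\<lambda>p. norm (p :: real \<times> real))"
proof (rule bigoI[of _ 1], intro always_eventually allI)
  show "norm (fst p) \<le> 1 * norm (norm p)" for p :: "real \<times> real"
    using norm_fst_le[of "fst p" "snd p"] by simp
qed

lemma snd_bigo_norm: "snd \<in> O[F](\<lambda>p. norm (p :: real \<times> real))"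
proof (rule bigoI[of _ 1], intro always_eventually allI)
  show "norm (snd p) \<le> 1 * norm (norm p)" for p :: "real \<times> real"
    using norm_snd_le[of "snd p" "fst p"] by simp
qed

lemma norm_power_smallo:
  assumes "m < n"
  shows "(\<lambda>p :: 'a::real_normed_vector. (norm p)^n) \<in> o[at 0](\<lambda>p. (norm p)^m)"
proof -
  have "(\<lambda>p :: 'a. (norm p)^(n - m) * (norm p)^m) \<in> o[at 0](\<lambda>p. 1 * (norm p)^m)"
    using assms
    by (intro landau_o.small_big_mult smalloI_tendsto)
       (auto intro!: tendsto_eq_intros simp: power_0_left)
  then show ?thesis using assms by (simp flip: power_add)
qed

text \<open>The first component depends on \<open>u\<close> alone, which makes the map triangular: injectivity near 0 can
  be checked one coordinate at a time.\<close>

definition BT_change :: "real \<Rightarrow> real \<Rightarrow> real \<Rightarrow> real \<Rightarrow> real \<times> real \<Rightarrow> real \<times> real" where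
  "BT_change \<alpha> \<kappa> \<mu> \<nu> p =
     (fst p + \<alpha> * (fst p)^2, snd p + \<kappa> * (fst p)^2 + \<mu> * fst p * snd p + \<nu> * (snd p)^2)"

lemma BT_change_near_identity: "near_identity_polynomial (BT_change \<alpha> \<kappa> \<mu> \<nu>)"
proof -
  have I: "{(i, j). 2 \<le> i + j \<and> i + j \<le> (2::nat)} = {(2, 0), (1, 1), (0, 2)}" by auto
  show ?thesis
    unfolding near_identity_polynomial_def
    by (rule exI[of _ 2], rule exI[of _ "\<lambda>i j. if i = 2 then \<alpha> else 0"],
        rule exI[of _ "\<lambda>i j. if i = 2 then \<kappa> else if i = 1 then \<mu> else \<nu>"])
       (simp add: I BT_change_def)
qed

lemma BT_change_frechet:
  "frechet_derivative (BT_change \<alpha> \<kappa> \<mu> \<nu>) (at p) h =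
    ((1 + 2 * \<alpha> * fst p) * fst h,
     (2 * \<kappa> * fst p + \<mu> * snd p) * fst h + (1 + \<mu> * fst p + 2 * \<nu> * snd p) * snd h)"
proof -
  have "(BT_change \<alpha> \<kappa> \<mu> \<nu> has_derivative (\<lambda>h. ((1 + 2 * \<alpha> * fst p) * fst h,
     (2 * \<kappa> * fst p + \<mu> * snd p) * fst h + (1 + \<mu> * fst p + 2 * \<nu> * snd p) * snd h))) (at p)"
    unfolding BT_change_def
    by (rule derivative_eq_intros refl)+ (simp add: fun_eq_iff algebra_simps)
  from fun_cong[OF frechet_derivative_at[OF this], of h, symmetric] show ?thesis .
qed

text \<open>The lower bound on the norm of the image transfers error estimates in the old coordinates to
  the new ones.\<close>

lemma BT_change_injective_near_0:
  obtains r where "r > 0" "inj_on (BT_change \<alpha> \<kappa> \<mu> \<nu>) (ball 0 r)"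
    "\<And>p. p \<in> ball 0 r \<Longrightarrow> norm p \<le> 2 * norm (BT_change \<alpha> \<kappa> \<mu> \<nu> p)"
proof -
  define M where "M = 1 + \<bar>\<alpha>\<bar> + \<bar>\<kappa>\<bar> + \<bar>\<mu>\<bar> + \<bar>\<nu>\<bar>"
  have M: "M \<ge> 1" by (simp add: M_def)
  \<comment> \<open>With this radius every coefficient times a coordinate is at most \<open>1/8\<close> in absolute value;
    at most four such products occur in each estimate.\<close>
  define r where "r = 1 / (8 * M)"
  have r: "r > 0" "M * r = 1/8" using M by (auto simp: r_def)
  have comp: "\<bar>fst p\<bar> < r" "\<bar>snd p\<bar> < r" if "p \<in> ball 0 r" for p :: "real \<times> real"
    using that norm_fst_le[of "fst p" "snd p"] norm_snd_le[of "snd p" "fst p"] by auto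
  have small: "\<bar>x * t\<bar> \<le> 1/8" if "\<bar>x\<bar> \<le> M" "\<bar>t\<bar> \<le> r" for x t
    using mult_mono[OF that] r M by (simp add: abs_mult)
  have coeff: "\<bar>\<alpha>\<bar> \<le> M" "\<bar>\<kappa>\<bar> \<le> M" "\<bar>\<mu>\<bar> \<le> M" "\<bar>\<nu>\<bar> \<le> M" by (auto simp: M_def)
  show ?thesis
  proof
    show "r > 0" by (fact r)
    show "inj_on (BT_change \<alpha> \<kappa> \<mu> \<nu>) (ball 0 r)"
    proof (rule inj_onI)
      fix p p' assume pp: "p \<in> ball 0 r" "p' \<in> ball 0 r"
        and eq: "BT_change \<alpha> \<kappa> \<mu> \<nu> p = BT_change \<alpha> \<kappa> \<mu> \<nu> p'"
      note s = comp[OF pp(1)] comp[OF pp(2)]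
      have "(fst p - fst p') * (1 + \<alpha> * fst p + \<alpha> * fst p') = 0"
        using eq by (simp add: BT_change_def algebra_simps power2_eq_square)
      moreover have "1 + \<alpha> * fst p + \<alpha> * fst p' > 0"
        using small[OF coeff(1), of "fst p"] small[OF coeff(1), of "fst p'"] s by auto
      ultimately have u: "fst p = fst p'" by simp
      have "(snd p - snd p') * (1 + \<mu> * fst p + \<nu> * snd p + \<nu> * snd p') = 0"
        using eq by (simp add: BT_change_def u algebra_simps power2_eq_square)
      moreover have "1 + \<mu> * fst p + \<nu> * snd p + \<nu> * snd p' > 0"
        using small[OF coeff(3), of "fst p"] small[OF coeff(4), of "snd p"]
          small[OF coeff(4), of "snd p'"] s by auto
      ultimately show "p = p'" using u by (simp add: prod_eq_iff)
    qed
    fix p :: "real \<times> real" assume p: "p \<in> ball 0 r"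
    define u v where "u = fst p" and "v = snd p"
    have s: "\<bar>u\<bar> < r" "\<bar>v\<bar> < r" using comp[OF p] by (auto simp: u_def v_def)
    have le: "\<bar>x * t * y\<bar> \<le> 1/8 * \<bar>y\<bar>" if "\<bar>x\<bar> \<le> M" "\<bar>t\<bar> < r" for x t y
      using mult_right_mono[OF small, of x t "\<bar>y\<bar>"] that by (simp add: abs_mult)
    have uv: "\<bar>u\<bar> \<le> norm p" "\<bar>v\<bar> \<le> norm p"
      using norm_fst_le[of u v] norm_snd_le[of v u] by (auto simp: u_def v_def)
    have "p - BT_change \<alpha> \<kappa> \<mu> \<nu> p =
        (- (\<alpha> * u * u), - (\<kappa> * u * u) - \<mu> * u * v - \<nu> * v * v)"
      by (simp add: BT_change_def u_def v_def prod_eq_iff power2_eq_square)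
    also have "norm \<dots> \<le> \<bar>- (\<alpha> * u * u)\<bar> + \<bar>- (\<kappa> * u * u) - \<mu> * u * v - \<nu> * v * v\<bar>"
      using norm_Pair_le[of "- (\<alpha> * u * u)" "- (\<kappa> * u * u) - \<mu> * u * v - \<nu> * v * v"]
      by simp
    also have "\<dots> \<le> 1/2 * norm p"
      using le[OF coeff(1) s(1), of u] le[OF coeff(2) s(1), of u] le[OF coeff(3) s(1), of v]
        le[OF coeff(4) s(2), of v] uv by linarith
    finally show "norm p \<le> 2 * norm (BT_change \<alpha> \<kappa> \<mu> \<nu> p)"
      using norm_triangle_sub[of p "BT_change \<alpha> \<kappa> \<mu> \<nu> p"] by linarith
  qed
qed

text \<open>A field that is pushed forward by \<open>\<Phi>\<close> on \<open>B\<close>, and is equal to its model outside the image of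
  \<open>B\<close>, has the error \<open>E\<close> on the image and no error elsewhere. The bound therefore holds at every
  point near 0.\<close>

lemma smallo_transport:
  fixes \<Phi> :: "'a::real_normed_vector \<Rightarrow> 'b::real_normed_vector" and E :: "'a \<Rightarrow> real" and h :: "'b \<Rightarrow> real"
  assumes E: "E \<in> o[at 0](\<lambda>p. (norm p)^2)"
    and \<Phi>: "\<Phi> 0 = 0" "\<And>p. p \<in> B \<Longrightarrow> norm p \<le> 2 * norm (\<Phi> p)"
    and h: "\<And>p. p \<in> B \<Longrightarrow> h (\<Phi> p) = E p" "\<And>w. w \<notin> \<Phi> ` B \<Longrightarrow> h w = 0"
  shows "h \<in> o[at 0](\<lambda>w. (norm w)^2)"
proof (rule landau_o.smallI)
  fix c :: real assume c: "c > 0"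
  from landau_o.smallD[OF E, of "c/4"] c obtain d where d: "d > 0"
    "\<And>p. p \<noteq> 0 \<Longrightarrow> norm p < d \<Longrightarrow> \<bar>E p\<bar> \<le> c/4 * (norm p)^2"
    by (auto simp: eventually_at)
  have "\<bar>h w\<bar> \<le> c * (norm w)^2" if w: "w \<noteq> 0" "norm w < d/2" for w
  proof (cases "w \<in> \<Phi> ` B")
    case True
    then obtain p where p: "p \<in> B" "w = \<Phi> p" by auto
    then have n: "norm p \<le> 2 * norm w" "p \<noteq> 0" using \<Phi> w by auto
    have "\<bar>h w\<bar> \<le> c/4 * (norm p)^2" using d(2)[of p] n w p h(1) by auto
    also have "\<dots> \<le> c/4 * (2 * norm w)^2" using n c by (intro mult_left_mono power_mono) auto
    finally show ?thesis by (simp add: power_mult_distrib)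
  qed (use c h(2) in auto)
  then show "\<forall>\<^sub>F w in at 0. norm (h w) \<le> c * norm ((norm w)^2)"
    unfolding eventually_at using d(1) by (intro exI[of _ "d/2"]) auto
qed

text \<open>The first component of the change has to be completed by \<open>F2 + 2 \<alpha> u v\<close> in the second one for the
  new first equation to be \<open>w1\<close> up to higher order. Differentiating that completion along the flow adds
  \<open>v \<partial>F2/\<partial>u + 2 \<alpha> v\<^sup>2 = 2 f20 u v + (f11 + 2 \<alpha>) v\<^sup>2\<close> to \<open>G2\<close>, so
  \<open>2 \<alpha> = - (g02 + f11)\<close> removes the term in \<open>v\<^sup>2\<close>.\<close>

lemma BT_coefficients_exist:
  fixes F G :: "real \<times> real \<Rightarrow> real"
  assumes X: "\<forall>\<^sub>F (u, v) in nhds 0.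
      X (u *\<^sub>R q0 + v *\<^sub>R q1) = (v + F (u, v)) *\<^sub>R q0 + G (u, v) *\<^sub>R q1"
    and F: "(\<lambda>p. F p - (f20 * (fst p)^2 + f11 * fst p * snd p + f02 * (snd p)^2))
        \<in> o[at 0](\<lambda>p. (norm p)^2)"
    and G: "(\<lambda>p. G p - (g20 * (fst p)^2 + g11 * fst p * snd p + g02 * (snd p)^2))
        \<in> o[at 0](\<lambda>p. (norm p)^2)"
  shows "BT_coefficients X q0 q1 g20 (g11 + 2 * f20)"
proof -
  define \<alpha> where "\<alpha> = - (g02 + f11) / 2"
  \<comment> \<open>The coefficient of \<open>u v\<close> in the second component of the change is \<open>f11 + 2 \<alpha> = - g02\<close>.\<close>
  define \<Phi> where "\<Phi> = BT_change \<alpha> f20 (- g02) f02"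
  define W where "W p = frechet_derivative \<Phi> (at p) (snd p + F p, G p)" for p
  define b where "b = g11 + 2 * f20"
  obtain r where r: "r > 0" "inj_on \<Phi> (ball 0 r)"
    "\<And>p. p \<in> ball 0 r \<Longrightarrow> norm p \<le> 2 * norm (\<Phi> p)"
    by (rule BT_change_injective_near_0[of \<alpha> f20 "- g02" f02, folded \<Phi>_def]) (rule that)
  \<comment> \<open>The pushed forward field on the image of the ball, and the exact normal form elsewhere.\<close>
  define Z where "Z w = (if w \<in> \<Phi> ` ball 0 r then W (inv_into (ball 0 r) \<Phi> w)
      else (snd w, g20 * (fst w)^2 + b * fst w * snd w))" for w
  have Z: "Z (\<Phi> p) = W p" if "p \<in> ball 0 r" for p
    using that r(2) by (simp add: Z_def)
  have \<Phi>0: "\<Phi> 0 = 0" by (simp add: \<Phi>_def BT_change_def prod_eq_iff)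
  let ?n = "\<lambda>n p. (norm (p :: real \<times> real))^n"
  have uv: "fst \<in> O[at 0](?n 1)" "snd \<in> O[at 0](?n 1)"
    using fst_bigo_norm snd_bigo_norm by simp_all
  have mult: "(\<lambda>p. h p * k p) \<in> O[at 0](?n (m + n))"
    if "h \<in> O[at 0](?n m)" "k \<in> O[at 0](?n n)" for h k :: "_ \<Rightarrow> real" and m n
    using landau_o.big.mult[OF that] by (simp add: power_add)
  have quad: "(\<lambda>p. x * (fst p)^2 + y * fst p * snd p + z * (snd p)^2) \<in> O[at 0](?n 2)" for x y z :: real
  proof -
    have *: "(\<lambda>p. fst p * fst p) \<in> O[at 0](?n 2)" "(\<lambda>p. fst p * snd p) \<in> O[at 0](?n 2)"
      "(\<lambda>p. snd p * snd p) \<in> O[at 0](?n 2)"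
      using mult[OF uv(1) uv(1)] mult[OF uv(1) uv(2)] mult[OF uv(2) uv(2)]
      by (simp_all add: numeral_2_eq_2)
    have c: "(\<lambda>p. x * h p) \<in> O[at 0](?n 2)" if "h \<in> O[at 0](?n 2)" for x and h :: "_ \<Rightarrow> real"
      using that by (cases "x = 0") simp_all
    have "(\<lambda>p. x * (fst p * fst p) + y * (fst p * snd p) + z * (snd p * snd p)) \<in> O[at 0](?n 2)"
      by (intro sum_in_bigo c *)
    then show ?thesis by (simp add: power2_eq_square mult.assoc)
  qed
  have FO: "F \<in> O[at 0](?n 2)" and GO: "G \<in> O[at 0](?n 2)"
    using sum_in_bigo(1)[OF landau_o.small_imp_big[OF F] quad[of f20 f11 f02]]
      sum_in_bigo(1)[OF landau_o.small_imp_big[OF G] quad[of g20 g11 g02]] by simp_all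
  have lin: "(\<lambda>p. x * fst p + y * snd p) \<in> O[at 0](?n 1)" for x y :: real
    using uv by (intro sum_in_bigo; (cases "x = 0"; cases "y = 0")?) simp_all
  have small: "(\<lambda>p. h p * k p) \<in> o[at 0](?n 2)"
    if "h \<in> O[at 0](?n m)" "k \<in> O[at 0](?n n)" "2 < m + n" for h k :: "_ \<Rightarrow> real" and m n
    using landau_o.big_small_trans[OF mult[OF that(1,2)] norm_power_smallo[OF that(3)]] .
  \<comment> \<open>The errors in the old coordinates. All terms of degree two cancel; what remains is a remainder of
    \<open>F\<close> or \<open>G\<close>, or a product of factors whose orders add up to at least three.\<close>
  define E0 where "E0 p = fst (W p) - snd (\<Phi> p)" for p
  define E1 where "E1 p = snd (W p) - (g20 * (fst (\<Phi> p))^2 + b * fst (\<Phi> p) * snd (\<Phi> p))" for p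
  define F2 where "F2 p = f20 * (fst p)^2 + f11 * fst p * snd p + f02 * (snd p)^2" for p :: "real \<times> real"
  define G2 where "G2 p = g20 * (fst p)^2 + g11 * fst p * snd p + g02 * (snd p)^2" for p :: "real \<times> real"
  have E0_eq: "E0 p = (F p - F2 p) + (2 * \<alpha> * fst p + 0 * snd p) * F p" for p
    unfolding E0_def W_def \<Phi>_def BT_change_frechet F2_def
    by (simp add: BT_change_def \<alpha>_def field_simps power2_eq_square)
  have E0: "E0 \<in> o[at 0](?n 2)"
    unfolding E0_eq F2_def by (intro sum_in_smallo F small[OF lin FO]) simp
  have E1_eq: "E1 p = (G p - G2 p) + (2 * f20 * fst p + (- g02) * snd p) * F p
      + ((- g02) * fst p + (2 * f02) * snd p) * G p
      - (1 * fst p + 0 * snd p) *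
          ((2 * \<alpha> * g20 + b * f20) * (fst p)^2 + (- b * g02) * fst p * snd p + (b * f02) * (snd p)^2)
      - (0 * fst p + 1 * snd p) * ((\<alpha> * b) * (fst p)^2 + 0 * fst p * snd p + 0 * (snd p)^2)
      - (\<alpha> * (fst p)^2 + 0 * fst p * snd p + 0 * (snd p)^2) *
          ((\<alpha> * g20 + b * f20) * (fst p)^2 + (- b * g02) * fst p * snd p + (b * f02) * (snd p)^2)" for p
    unfolding E1_def W_def \<Phi>_def BT_change_frechet G2_def
    by (simp add: BT_change_def b_def algebra_simps power2_eq_square)
  have E1: "E1 \<in> o[at 0](?n 2)"
    unfolding E1_eq G2_def
    by (intro sum_in_smallo G small[OF lin FO] small[OF lin GO] small[OF lin quad] small[OF quad quad]) simp_all
  have "(\<lambda>w. fst (Z w) - snd w) \<in> o[at 0](\<lambda>w. (norm w)^2)"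
    by (rule smallo_transport[OF E0 \<Phi>0 r(3), of "ball 0 r"]) (auto simp: Z E0_def, simp add: Z_def)
  moreover have "(\<lambda>w. snd (Z w) - (g20 * (fst w)^2 + b * fst w * snd w)) \<in> o[at 0](\<lambda>w. (norm w)^2)"
    by (rule smallo_transport[OF E1 \<Phi>0 r(3), of "ball 0 r"]) (auto simp: Z E1_def, simp add: Z_def)
  moreover have "\<forall>\<^sub>F (u, v) in nhds 0.
      frechet_derivative \<Phi> (at (u, v)) (v + F (u, v), G (u, v)) = Z (\<Phi> (u, v))"
    using eventually_nhds_in_open[of "ball 0 r" "0 :: real \<times> real"] r(1)
    by (auto elim!: eventually_mono simp: Z W_def)
  ultimately show ?thesis
    unfolding BT_coefficients_def b_def[symmetric]
    by (intro exI[of _ F] exI[of _ G] exI[of _ \<Phi>] exI[of _ Z] conjI X FO GO)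
       (simp_all only: \<Phi>_def BT_change_near_identity)
qed

section \<open>The distinguished restriction and the Bogdanov--Takens coefficient\<close>

theorem proposition2p5:
  fixes X :: "real^2 \<Rightarrow> real^2" and U :: "(real^2) set" and q0 :: "real^2"
  assumes "open U" and "0 \<in> U" and "C2_on U X"
    and "X 0 = 0"
    and "jacobian X (at 0) \<noteq> 0"
    and "jacobian X (at 0) ** jacobian X (at 0) = 0"
    and "q0 \<noteq> 0"
    and "{x. jacobian X (at 0) *v x = 0} = span {q0}"
  shows "let R = distinguished_restriction X q0; g2 = quadratic_taylor_coeff R in
      (\<forall>\<^sub>F u in nhds 0. jacobian X (at 0) *v X (u *\<^sub>R q0) = R u *\<^sub>R q0) \<and>
      (\<lambda>u. R u - g2 * u^2) \<in> o[at 0](\<lambda>u. u^2) \<and>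
      (\<lambda>x. det (jacobian X (at x))) differentiable (at 0) \<and>
      g2 = - (1/2) * directional_derivative q0 (\<lambda>x. det (jacobian X (at x))) 0 \<and>
      (\<exists>q1. jacobian X (at 0) *v q1 = q0) \<and>
      (\<forall>q1. jacobian X (at 0) *v q1 = q0 \<longrightarrow>
         (\<exists>a b. BT_coefficients X q0 q1 a b) \<and>
         (\<forall>a b. BT_coefficients X q0 q1 a b \<longrightarrow> g2 = a))"
proof -
  define A where "A = jacobian X (at 0)"
  obtain f' f'' where f': "\<And>x. x \<in> U \<Longrightarrow> (X has_derivative blinfun_apply (f' x)) (at x)"
    and f''U: "\<And>x. x \<in> U \<Longrightarrow> (f' has_derivative blinfun_apply (f'' x)) (at x)"
    using \<open>C2_on U X\<close> unfolding C2_on_def by blast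
  define H where "H = f'' 0"
  have f'': "(f' has_derivative H) (at 0)" using f''U \<open>0 \<in> U\<close> by (simp add: H_def)
  have A: "A *v z = f' 0 z" for z
    unfolding A_def jacobian_def frechet_derivative_at[OF f'[OF \<open>0 \<in> U\<close>], symmetric]
    by (rule matrix_works)
      (metis bounded_linear.linear[OF blinfun.bounded_linear_right] linear_matrix_vector_mul_eq)
  have ker: "A *v z = 0 \<longleftrightarrow> (\<exists>c. z = c *\<^sub>R q0)" for z
    using assms(8) unfolding A_def[symmetric] span_singleton by auto
  define l1 where "l1 z = (A *v z) \<bullet> q0 / (q0 \<bullet> q0)" for z
  \<comment> \<open>\<open>A\<^sup>2 = 0\<close> puts the image of \<open>A\<close> into its kernel, the line through \<open>q0\<close>.\<close>
  have l1: "A *v z = l1 z *\<^sub>R q0" for z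
  proof -
    have "A *v (A *v z) = 0"
      using assms(6) by (simp add: A_def matrix_vector_mul_assoc)
    then show ?thesis using ker \<open>q0 \<noteq> 0\<close> by (auto simp: l1_def)
  qed
  have bl1: "bounded_linear l1"
    unfolding l1_def[abs_def] linear_conv_bounded_linear[symmetric]
    by (rule linearI) (simp_all add: matrix_vector_right_distrib matrix_vector_mult_scaleR inner_add_left add_divide_distrib)
  then have lin1: "linear l1" by (rule bounded_linear.linear)
  have l1q0: "l1 q0 = 0" using ker[of q0] by (simp add: l1_def) (metis scaleR_one inner_zero_left)
  have Aq0: "A *v q0 = 0" using l1[of q0] l1q0 by simp
  define R where "R = distinguished_restriction X q0"
  have R: "R u = l1 (X (u *\<^sub>R q0))" for u
    unfolding R_def distinguished_restriction_def A_def[symmetric] l1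
    using \<open>q0 \<noteq> 0\<close> by simp
  define g2 where "g2 = quadratic_taylor_coeff R"
  have expansion: "(\<lambda>u. R u - (1/2) * l1 (H q0 q0) * u^2) \<in> o[at 0](\<lambda>u. u^2)"
    using second_order_taylor_coordinates[OF assms(1,2) f' f'' bounded_linear_scaleR_left _ bl1, of q0]
      \<open>q0 \<noteq> 0\<close> l1q0
    by (simp add: R A[symmetric] Aq0 assms(4) matrix_vector_mult_scaleR blinfun.bilinear_simps
        linear_simps[OF bl1] linear_scale[OF lin1] power2_eq_square algebra_simps)
  then have g2: "g2 = (1/2) * l1 (H q0 q0)"
    unfolding g2_def by (rule quadratic_taylor_coeff_eqI)
  obtain D where D: "((\<lambda>x. det (jacobian X (at x))) has_derivative D) (at 0)" "D q0 = - l1 (H q0 q0)"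
    using det_jacobian_has_derivative[OF assms(1,2) f' f'' lin1 l1q0] l1 A by metis
  have ex: "\<exists>q1. A *v q1 = q0"
  proof -
    obtain y where "A *v y \<noteq> 0"
      using assms(5) unfolding A_def[symmetric] by (metis matrix_eq matrix_vector_mult_0)
    then have "l1 y \<noteq> 0" using l1[of y] by auto
    then have "A *v ((1 / l1 y) *\<^sub>R y) = q0" by (simp add: matrix_vector_mult_scaleR l1)
    then show ?thesis by blast
  qed
  have BT: "(\<exists>a b. BT_coefficients X q0 q1 a b) \<and> (\<forall>a b. BT_coefficients X q0 q1 a b \<longrightarrow> g2 = a)"
    if q1: "A *v q1 = q0" for q1
  proof -
    have l1q1: "l1 q1 = 1" using q1 \<open>q0 \<noteq> 0\<close> by (simp add: l1_def)
    \<comment> \<open>\<open>l0\<close> and \<open>l1\<close> are the coordinates of the basis \<open>q0\<close>, \<open>q1\<close>.\<close>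
    define l0 where "l0 z = (z - l1 z *\<^sub>R q1) \<bullet> q0 / (q0 \<bullet> q0)" for z
    have bl0: "bounded_linear l0"
      unfolding l0_def[abs_def] linear_conv_bounded_linear[symmetric]
      by (rule linearI) (simp_all add: linear_add[OF lin1] linear_scale[OF lin1] inner_simps algebra_simps add_divide_distrib diff_divide_distrib)
    have decomp: "z = l0 z *\<^sub>R q0 + l1 z *\<^sub>R q1" for z
    proof -
      have "A *v (z - l1 z *\<^sub>R q1) = 0"
        by (simp add: matrix_vector_mult_diff_distrib matrix_vector_mult_scaleR q1 l1 l1q1)
      then obtain c where c: "z - l1 z *\<^sub>R q1 = c *\<^sub>R q0" using ker by blast
      then have "l0 z = c" using \<open>q0 \<noteq> 0\<close> by (simp add: l0_def)
      then show ?thesis using c by (simp add: algebra_simps)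
    qed
    have l0q: "l0 q0 = 1" "l0 q1 = 0" using \<open>q0 \<noteq> 0\<close> by (simp_all add: l0_def l1q0 l1q1)
    define T where "T p = fst p *\<^sub>R q0 + snd p *\<^sub>R q1" for p
    have T: "bounded_linear T"
      unfolding T_def[abs_def] by (intro bounded_linear_intros)
    have lT: "l0 (T p) = fst p" "l1 (T p) = snd p" for p
      by (simp_all add: T_def linear_simps[OF bl0] linear_simps[OF bl1] l0q l1q0 l1q1)
    have T0: "p = 0" if "T p = 0" for p
      using lT[of p] linear_simps(3)[OF bl0] linear_simps(3)[OF bl1] that by (simp add: prod_eq_iff)
    have AT: "f' 0 (T p) = snd p *\<^sub>R q0" for p
      using A l1 lT by metis
    have HT: "l (H (T p) (T p)) = l (H q0 q0) * (fst p)^2 + (l (H q0 q1) + l (H q1 q0)) * fst p * snd p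
        + l (H q1 q1) * (snd p)^2" if "bounded_linear l" for l :: "real^2 \<Rightarrow> real" and p
      by (simp add: T_def blinfun.bilinear_simps linear_simps[OF that] power2_eq_square algebra_simps)
    have taylor: "(\<lambda>p. l (X (T p)) - l (X 0) - l (f' 0 (T p)) - (1/2) * l (H (T p) (T p)))
        \<in> o[at 0](\<lambda>p. (norm p)^2)" if "bounded_linear l" for l
      by (rule second_order_taylor_coordinates[OF assms(1,2) f' f'' T T0 that])
    define F where "F p = l0 (X (T p)) - snd p" for p
    define G where "G p = l1 (X (T p))" for p
    have F: "(\<lambda>p. F p - ((1/2 * l0 (H q0 q0)) * (fst p)^2
        + (1/2 * (l0 (H q0 q1) + l0 (H q1 q0))) * fst p * snd p
        + (1/2 * l0 (H q1 q1)) * (snd p)^2)) \<in> o[at 0](\<lambda>p. (norm p)^2)"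
      using taylor[OF bl0] by (simp add: F_def AT HT[OF bl0] assms(4) linear_simps[OF bl0] l0q algebra_simps)
    have G: "(\<lambda>p. G p - (g2 * (fst p)^2
        + (1/2 * (l1 (H q0 q1) + l1 (H q1 q0))) * fst p * snd p
        + (1/2 * l1 (H q1 q1)) * (snd p)^2)) \<in> o[at 0](\<lambda>p. (norm p)^2)"
      using taylor[OF bl1] by (simp add: G_def g2 AT HT[OF bl1] assms(4) linear_simps[OF bl1] l1q0 algebra_simps)
    have "\<forall>\<^sub>F (u, v) in nhds 0.
        X (u *\<^sub>R q0 + v *\<^sub>R q1) = (v + F (u, v)) *\<^sub>R q0 + G (u, v) *\<^sub>R q1"
      using decomp by (intro always_eventually) (auto simp: F_def G_def T_def)
    from BT_coefficients_exist[OF this F G]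
    have "\<exists>a b. BT_coefficients X q0 q1 a b" by blast
    moreover have "g2 = a" if "BT_coefficients X q0 q1 a b" for a b
      unfolding g2_def R
      using BT_coefficients_leading[OF that lin1 l1q0 l1q1]
      by (intro quadratic_taylor_coeff_eqI) (simp add: R)
    ultimately show ?thesis by blast
  qed
  have "\<forall>\<^sub>F u in nhds 0. A *v X (u *\<^sub>R q0) = R u *\<^sub>R q0"
    by (simp add: R l1)
  moreover have "(\<lambda>u. R u - g2 * u^2) \<in> o[at 0](\<lambda>u. u^2)"
    using expansion by (simp add: g2)
  moreover have "(\<lambda>x. det (jacobian X (at x))) differentiable (at 0)"
    using D(1) by (auto simp: differentiable_def)
  moreover have "g2 = - (1/2) * directional_derivative q0 (\<lambda>x. det (jacobian X (at x))) 0"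
    by (simp add: directional_derivative_eq[OF D(1)] D(2) g2)
  ultimately show ?thesis
    unfolding Let_def R_def[symmetric] g2_def[symmetric] A_def[symmetric] using ex BT by blast
qed
end
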